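(* Let $\alpha=\alpha(n)=n/\log^4 n$, and let $\mathcal{J}_n(\alpha)$ denote the family of all $\alpha$-generalized Sidon sets $I\subseteq[n]$ such that $$\left|\{v\in I:\ s_I(v)\geq \sqrt{n}/\log^4 n\}\right|\leq \sqrt{n}/\log n.$$ Then for all sufficiently large $n$, $$|\mathcal{J}_n(\alpha)|\leq 2^{180\sqrt{n}}.$$
   Context: All logarithms are to base 2, and $[n]=\{1,\dots,n\}$. A Sidon 4-tuple in a set $A$ of nonnegative integers is an (ordered) 4-tuple $(a,b,c,d)$ of elements of $A$ with $a+b=c+d$ and $\{a,b\}\cap\{c,d\}=\emptyset$. For $\alpha\geq 0$, an $\alpha$-generalized Sidon set in $[n]$ is a set $I\subseteq[n]$ containing at most $\alpha$ Sidon 4-tuples. For $I\subseteq[n]$ and an integer $v$, $S_I(v)$ denotes the set of Sidon 4-tuples in $I$ having $v$ as one of their entries, and $s_I(v)=|S_I(v)|$. *)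

theory Defs
  imports Complex_Main
begin

definition sidon_tuples :: "nat set \<Rightarrow> (nat \<times> nat \<times> nat \<times> nat) set" where
  "sidon_tuples A = {(a, b, c, d). a \<in> A \<and> b \<in> A \<and> c \<in> A \<and> d \<in> A \<and>
     a + b = c + d \<and> {a, b} \<inter> {c, d} = {}}"

definition generalized_sidon :: "nat \<Rightarrow> real \<Rightarrow> nat set \<Rightarrow> bool" where
  "generalized_sidon n \<alpha> I \<longleftrightarrow> I \<subseteq> {1..n} \<and> real (card (sidon_tuples I)) \<le> \<alpha>"

definition sidon_tuples_at :: "nat set \<Rightarrow> nat \<Rightarrow> (nat \<times> nat \<times> nat \<times> nat) set" where
  "sidon_tuples_at I v = {(a, b, c, d). (a, b, c, d) \<in> sidon_tuples I \<and> v \<in> {a, b, c, d}}"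

definition sidon_degree :: "nat set \<Rightarrow> nat \<Rightarrow> nat" where
  "sidon_degree I v = card (sidon_tuples_at I v)"

definition sidon_family :: "nat \<Rightarrow> real \<Rightarrow> nat set set" where
  "sidon_family n \<alpha> = {I. generalized_sidon n \<alpha> I \<and>
     real (card {v \<in> I. real (sidon_degree I v) \<ge> sqrt (real n) / (log 2 (real n)) ^ 4})
       \<le> sqrt (real n) / log 2 (real n)}"

end

theory Submission
  imports Defs "HOL-Analysis.Convex" "HOL-Real_Asymp.Real_Asymp"
begin

text \<open>
  Write \<open>r = sqrt n\<close>, \<open>L = log n\<close>. The at most \<open>r / L\<close> elements of large degree can be chosen in
  \<open>2\<close> to the \<open>O(r)\<close> ways, so it suffices to count the sets \<open>I\<close> all of whose elements have degree below
  \<open>D\<close>, which is about \<open>r / L ^ 4\<close>. Given a subset \<open>S\<close> of \<open>I\<close> with \<open>s\<close> elements, weight a pair \<open>(u, v)\<close> by the number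
  of \<open>(a, b)\<close> in \<open>S \<times> S\<close> with \<open>a \<noteq> b\<close> and \<open>u + a = v + b\<close>. In this graph \<open>I - S\<close> has maximum degree below \<open>D\<close>,
  whereas by Cauchy--Schwarz every set \<open>U\<close> of more than \<open>4 n / s\<close> vertices contains a vertex of degree
  at least \<open>s\<^sup>2 |U| / (4 n)\<close> in \<open>U\<close>. A Kleitman--Winston argument then places \<open>I - S\<close> in a container of size about \<open>4 n / s\<close>
  determined by a fingerprint of \<open>O(n D L / s\<^sup>2)\<close> elements. Starting from \<open>s\<close> about \<open>r / L\<close>, one repeatedly
  doubles \<open>S\<close> inside the container until \<open>s \<ge> r\<close>, when the container itself has \<open>O(r)\<close> elements;
  the costs of the doublings sum to \<open>O(r)\<close>.
\<close>

section \<open>Counting the small subsets of a finite set\<close>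

text \<open>Weight \<open>X\<close> by \<open>x ^ card X\<close>: the weights over
  \<open>Pow C\<close> sum to the right-hand side, and as \<open>x \<le> 1\<close> every counted set
  weighs at least \<open>x ^ s\<close>.\<close>

lemma card_small_subsets_weighted_le:
  fixes x :: real
  assumes "finite C" "0 \<le> x" "x \<le> 1"
  shows "real (card {X. X \<subseteq> C \<and> card X \<le> s}) * x ^ s \<le> (1 + x) ^ card C"
proof -
  have Pow: "(\<Sum>X\<in>Pow C. x ^ card X) = (1 + x) ^ card C"
    using prod_add[OF \<open>finite C\<close>, of "\<lambda>_. x" "\<lambda>_. 1"] by (simp add: add.commute)
  have "real (card {X. X \<subseteq> C \<and> card X \<le> s}) * x ^ s = (\<Sum>X | X \<subseteq> C \<and> card X \<le> s. x ^ s)"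
    by simp
  also have "\<dots> \<le> (\<Sum>X | X \<subseteq> C \<and> card X \<le> s. x ^ card X)"
    using assms by (intro sum_mono power_decreasing) auto
  also have "\<dots> \<le> (\<Sum>X\<in>Pow C. x ^ card X)"
    using assms by (intro sum_mono2) auto
  finally show ?thesis
    using Pow by simp
qed

text \<open>The weight \<open>x = s / N\<close> keeps \<open>(1 + x) ^ card C\<close> below
  \<open>exp s\<close>. A real \<open>N\<close> lets the real bounds on container sizes be inserted
  directly.\<close>

lemma card_small_subsets_le:
  fixes N :: real
  assumes "finite C" "real (card C) \<le> N" "0 < s" "real s \<le> N"
  shows "real (card {X. X \<subseteq> C \<and> card X \<le> s}) \<le> (exp 1 * N / real s) ^ s"
proof -
  define x where "x = real s / N"
  have x: "0 < x" "x \<le> 1"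
    using assms by (auto simp: x_def field_simps)
  have "real (card {X. X \<subseteq> C \<and> card X \<le> s}) * x ^ s \<le> (1 + x) ^ card C"
    using card_small_subsets_weighted_le[OF assms(1), of x s] x by simp
  also have "\<dots> \<le> exp x ^ card C"
    using x by (intro power_mono exp_ge_add_one_self) auto
  also have "\<dots> = exp (real (card C) * x)"
    by (simp add: exp_of_nat_mult)
  also have "\<dots> \<le> exp (N * x)"
    using assms x by (simp add: mult_right_mono)
  also have "N * x = real s"
    using assms by (simp add: x_def)
  also have "exp (real s) = exp 1 ^ s"
    by (metis exp_of_nat_mult mult.right_neutral)
  finally have "real (card {X. X \<subseteq> C \<and> card X \<le> s}) \<le> (exp 1) ^ s / x ^ s"
    using x by (simp add: field_simps)
  also have "\<dots> = (exp 1 * N / real s) ^ s"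
    using assms by (simp add: x_def power_divide power_mult_distrib)
  finally show ?thesis .
qed

section \<open>The Kleitman--Winston container recursion\<close>

text \<open>
  The recursion decides whether a vertex of weight at least \<open>\<beta> |U|\<close> into \<open>U\<close> belongs to the set. If so, it
  joins the fingerprint \<open>T\<close>, and all vertices that received more than \<open>D\<close> weight from \<open>T\<close> are discarded.
  The potential \<open>\<Sum>u\<in>U. 2 D - (\<Sum>t\<in>T. w t u)\<close> never increases, lies between \<open>D |U|\<close> and \<open>2 D |U|\<close>, and
  shrinks by the factor \<open>1 - \<beta> / (2 D)\<close> whenever \<open>T\<close> grows.
\<close>

lemma container_cover_aux:
  fixes w :: "'a \<Rightarrow> 'a \<Rightarrow> real" and D \<beta> R :: real
  assumes fin: "finite V" and D: "0 < D" and R: "0 \<le> R"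
    and w_nonneg: "\<And>u v. 0 \<le> w u v" and w_le: "\<And>u v. w u v \<le> D"
    and dense: "\<And>U. U \<subseteq> V \<Longrightarrow> R < real (card U) \<Longrightarrow>
      \<exists>v\<in>U. \<beta> * real (card U) \<le> (\<Sum>u\<in>U. w v u)"
    and beta: "0 \<le> \<beta>"
  shows "U \<subseteq> V \<Longrightarrow> finite T \<Longrightarrow> U \<inter> T = {} \<Longrightarrow>
    (\<And>u. u \<in> U \<Longrightarrow> (\<Sum>t\<in>T. w t u) \<le> D) \<Longrightarrow>
    (\<Sum>u\<in>U. 2 * D - (\<Sum>t\<in>T. w t u)) * exp (- (real k * \<beta> / (2 * D))) \<le> D * R \<Longrightarrow>
    \<exists>\<C>. finite \<C> \<and> card \<C> \<le> (card U + 1) ^ k \<and>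
      (\<forall>C\<in>\<C>. finite C \<and> real (card C) \<le> R + real (card T + k)) \<and>
      (\<forall>I. T \<subseteq> I \<and> I \<subseteq> T \<union> U \<and> (\<forall>u\<in>I. (\<Sum>t\<in>I. w t u) \<le> D) \<longrightarrow> (\<exists>C\<in>\<C>. I \<subseteq> C))"
proof (induction "card U" arbitrary: U T k rule: less_induct)
  case less
  have finU: "finite U"
    using less.prems(1) fin by (rule finite_subset)
  show ?case
  proof (cases "real (card U) \<le> R")
    case True
    have "card (T \<union> U) \<le> card T + card U"
      by (rule card_Un_le)
    then have "real (card (T \<union> U)) \<le> R + real (card T + k)"
      using True by linarith
    then show ?thesis
      using finU less.prems(2) by (intro exI[of _ "{T \<union> U}"]) auto
  next
    case False
    define \<Psi> where "\<Psi> = (\<Sum>u\<in>U. 2 * D - (\<Sum>t\<in>T. w t u))"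
    have \<Psi>_le: "\<Psi> \<le> 2 * D * real (card U)"
      unfolding \<Psi>_def using sum_mono[of U "\<lambda>u. 2 * D - (\<Sum>t\<in>T. w t u)" "\<lambda>_. 2 * D"]
      by (simp add: sum_nonneg w_nonneg mult.commute)
    have \<Psi>_ge: "D * real (card U) \<le> \<Psi>"
      unfolding \<Psi>_def using sum_mono[of U "\<lambda>_. D" "\<lambda>u. 2 * D - (\<Sum>t\<in>T. w t u)"] less.prems(4)
      by (simp add: mult.commute)
    have \<Psi>0: "0 \<le> \<Psi>"
      by (rule order_trans[OF _ \<Psi>_ge]) (use D in simp)
    \<comment> \<open>The fingerprint cannot run out of room while \<open>U\<close> is large: with
      \<open>k = 0\<close> the potential, which is at least \<open>D * card U\<close>, would be at
      most \<open>D * R\<close>.\<close>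
    have "k \<noteq> 0"
    proof
      assume "k = 0"
      then have "D * real (card U) \<le> D * R"
        using less.prems(5) \<Psi>_ge unfolding \<Psi>_def by simp
      then show False
        using False D by simp
    qed
    then obtain j where k: "k = Suc j"
      by (cases k) auto
    obtain v where v: "v \<in> U" "\<beta> * real (card U) \<le> (\<Sum>u\<in>U. w v u)"
      using dense[OF less.prems(1)] False by auto
    have vT: "v \<notin> T"
      using v less.prems(3) by auto
    \<comment> \<open>If \<open>v\<close> belongs to \<open>I\<close>, a vertex receiving more than
      \<open>D\<close> from \<open>insert v T\<close> cannot, because
      \<open>insert v T \<subseteq> I\<close> and the weights are nonnegative.\<close>
    define U' where "U' = {u \<in> U - {v}. (\<Sum>t\<in>insert v T. w t u) \<le> D}"
    have c': "(\<Sum>t\<in>insert v T. w t u) = w v u + (\<Sum>t\<in>T. w t u)" for u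
      using vT less.prems(2) by simp
    have U'U: "U' \<subseteq> U - {v}"
      by (auto simp: U'_def)
    have cardUv: "card (U - {v}) + 1 = card U"
      using v finU by (metis Suc_eq_plus1 card_Suc_Diff1)
    have cardU': "card U' \<le> card (U - {v})"
      using U'U finU by (intro card_mono) auto
    have nonneg: "0 \<le> 2 * D - (\<Sum>t\<in>T. w t u)" if "u \<in> U" for u
      using less.prems(4)[OF that] D by simp
    have "(\<Sum>u\<in>U'. 2 * D - (\<Sum>t\<in>insert v T. w t u)) \<le> (\<Sum>u\<in>U. 2 * D - (\<Sum>t\<in>insert v T. w t u))"
    proof (rule sum_mono2)
      \<comment> \<open>This is why the potential uses \<open>2 * D\<close>: one new fingerprint
        vertex adds at most \<open>D\<close> to a sum that was at most \<open>D\<close>, so the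
        terms of discarded vertices are still nonnegative.\<close>
      show "0 \<le> 2 * D - (\<Sum>t\<in>insert v T. w t u)" if "u \<in> U - U'" for u
        unfolding c' using w_le[of v u] less.prems(4)[of u] that by auto
    qed (use finU U'U in auto)
    also have "\<dots> = \<Psi> - (\<Sum>u\<in>U. w v u)"
      unfolding c' \<Psi>_def sum_subtractf[symmetric] by (intro sum.cong) auto
    also have "\<dots> \<le> \<Psi> - \<beta> * real (card U)"
      using v by simp
    also have "\<dots> \<le> \<Psi> * (1 + - (\<beta> / (2 * D)))"
    proof -
      have "\<beta> / (2 * D) * \<Psi> \<le> \<beta> / (2 * D) * (2 * D * real (card U))"
        using \<Psi>_le beta D by (intro mult_left_mono) auto
      also have "\<dots> = \<beta> * real (card U)"
        using D by simp
      finally show ?thesis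
        by (simp add: algebra_simps)
    qed
    also have "\<dots> \<le> \<Psi> * exp (- (\<beta> / (2 * D)))"
      using \<Psi>0 by (intro mult_left_mono exp_ge_add_one_self)
    finally have "(\<Sum>u\<in>U'. 2 * D - (\<Sum>t\<in>insert v T. w t u)) * exp (- (real j * \<beta> / (2 * D)))
      \<le> \<Psi> * exp (- (\<beta> / (2 * D))) * exp (- (real j * \<beta> / (2 * D)))"
      by (intro mult_right_mono) auto
    also have "\<dots> = \<Psi> * exp (- (real k * \<beta> / (2 * D)))"
      unfolding mult.assoc exp_add[symmetric] k by (simp add: add_divide_distrib distrib_right)
    also have "\<dots> \<le> D * R"
      using less.prems(5) unfolding \<Psi>_def .
    finally have pot_yes: "(\<Sum>u\<in>U'. 2 * D - (\<Sum>t\<in>insert v T. w t u))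
      * exp (- (real j * \<beta> / (2 * D))) \<le> D * R" .
    have "\<exists>\<C>. finite \<C> \<and> card \<C> \<le> (card U' + 1) ^ j \<and>
      (\<forall>C\<in>\<C>. finite C \<and> real (card C) \<le> R + real (card (insert v T) + j)) \<and>
      (\<forall>I. insert v T \<subseteq> I \<and> I \<subseteq> insert v T \<union> U' \<and> (\<forall>u\<in>I. (\<Sum>t\<in>I. w t u) \<le> D)
         \<longrightarrow> (\<exists>C\<in>\<C>. I \<subseteq> C))"
    proof (rule less.hyps)
      show "card U' < card U" using cardU' cardUv by simp
      show "U' \<subseteq> V" using U'U less.prems(1) by auto
      show "finite (insert v T)" using less.prems(2) by simp
      show "U' \<inter> insert v T = {}" using U'U less.prems(3) by auto
      show "(\<Sum>t\<in>insert v T. w t u) \<le> D" if "u \<in> U'" for u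
        using that by (simp add: U'_def)
    qed (rule pot_yes)
    then obtain \<C>1 where C1: "finite \<C>1" "card \<C>1 \<le> (card U' + 1) ^ j"
      "\<forall>C\<in>\<C>1. finite C \<and> real (card C) \<le> R + real (card (insert v T) + j)"
      "\<forall>I. insert v T \<subseteq> I \<and> I \<subseteq> insert v T \<union> U' \<and> (\<forall>u\<in>I. (\<Sum>t\<in>I. w t u) \<le> D)
         \<longrightarrow> (\<exists>C\<in>\<C>1. I \<subseteq> C)"
      by (elim exE conjE)
    \<comment> \<open>Rejecting \<open>v\<close> only removes a nonnegative term, so it consumes
      nothing of \<open>k\<close>.\<close>
    have pot_no: "(\<Sum>u\<in>U - {v}. 2 * D - (\<Sum>t\<in>T. w t u)) * exp (- (real k * \<beta> / (2 * D))) \<le> D * R"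
    proof -
      have "(\<Sum>u\<in>U - {v}. 2 * D - (\<Sum>t\<in>T. w t u)) \<le> \<Psi>"
        unfolding \<Psi>_def using finU nonneg by (intro sum_mono2) auto
      then have "(\<Sum>u\<in>U - {v}. 2 * D - (\<Sum>t\<in>T. w t u)) * exp (- (real k * \<beta> / (2 * D)))
        \<le> \<Psi> * exp (- (real k * \<beta> / (2 * D)))"
        by (intro mult_right_mono) auto
      then show ?thesis
        using less.prems(5) unfolding \<Psi>_def by linarith
    qed
    have "\<exists>\<C>. finite \<C> \<and> card \<C> \<le> (card (U - {v}) + 1) ^ k \<and>
      (\<forall>C\<in>\<C>. finite C \<and> real (card C) \<le> R + real (card T + k)) \<and>
      (\<forall>I. T \<subseteq> I \<and> I \<subseteq> T \<union> (U - {v}) \<and> (\<forall>u\<in>I. (\<Sum>t\<in>I. w t u) \<le> D) \<longrightarrow> (\<exists>C\<in>\<C>. I \<subseteq> C))"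
    proof (rule less.hyps)
      show "card (U - {v}) < card U" using cardUv by simp
      show "U - {v} \<subseteq> V" "(U - {v}) \<inter> T = {}"
        using less.prems(1,3) by auto
      show "(\<Sum>t\<in>T. w t u) \<le> D" if "u \<in> U - {v}" for u
        using less.prems(4) that by simp
    qed (rule less.prems(2) pot_no)+
    then obtain \<C>2 where C2: "finite \<C>2" "card \<C>2 \<le> (card (U - {v}) + 1) ^ k"
      "\<forall>C\<in>\<C>2. finite C \<and> real (card C) \<le> R + real (card T + k)"
      "\<forall>I. T \<subseteq> I \<and> I \<subseteq> T \<union> (U - {v}) \<and> (\<forall>u\<in>I. (\<Sum>t\<in>I. w t u) \<le> D)
         \<longrightarrow> (\<exists>C\<in>\<C>2. I \<subseteq> C)"
      by (elim exE conjE)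
    have "card (\<C>1 \<union> \<C>2) \<le> card \<C>1 + card \<C>2"
      by (rule card_Un_le)
    \<comment> \<open>Both branches work in at most \<open>card U - 1\<close> vertices; accepting
      \<open>v\<close> lowers the exponent by one, rejecting it keeps the exponent.\<close>
    also have "\<dots> \<le> card U ^ j + card U ^ k"
    proof (rule add_mono)
      show "card \<C>1 \<le> card U ^ j"
        using C1(2) power_mono[of "card U' + 1" "card U" j] cardU' cardUv by linarith
      show "card \<C>2 \<le> card U ^ k"
        using C2(2) cardUv by simp
    qed
    also have "\<dots> = (card U + 1) * card U ^ j"
      by (simp add: k)
    also have "\<dots> \<le> (card U + 1) ^ k"
      unfolding k power_Suc by (intro mult_left_mono power_mono) auto
    finally have card12: "card (\<C>1 \<union> \<C>2) \<le> (card U + 1) ^ k" .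
    have cover: "\<exists>C\<in>\<C>1 \<union> \<C>2. I \<subseteq> C"
      if I: "T \<subseteq> I" "I \<subseteq> T \<union> U" "\<forall>u\<in>I. (\<Sum>t\<in>I. w t u) \<le> D" for I
    proof (cases "v \<in> I")
      case True
      have finI: "finite I"
        using I(2) finU less.prems(2) by (meson finite_UnI finite_subset)
      have "(\<Sum>t\<in>insert v T. w t u) \<le> D" if "u \<in> I" for u
      proof -
        have "(\<Sum>t\<in>insert v T. w t u) \<le> (\<Sum>t\<in>I. w t u)"
          using True I(1) finI w_nonneg by (intro sum_mono2) auto
        then show ?thesis
          using I(3) that by force
      qed
      then have "I \<subseteq> insert v T \<union> U'"
        using I(2) by (auto simp: U'_def)
      then show ?thesis
        using C1(4)[rule_format, of I] True I by auto
    next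
      case False
      then show ?thesis
        using C2(4)[rule_format, of I] I by auto
    qed
    have "real (card C) \<le> R + real (card T + k)" "finite C" if "C \<in> \<C>1 \<union> \<C>2" for C
      using that C1(3)[rule_format, of C] C2(3)[rule_format, of C] less.prems(2) vT by (auto simp: k)
    then show ?thesis
      using C1(1) C2(1) card12 cover by (intro exI[of _ "\<C>1 \<union> \<C>2"]) auto
  qed
qed

text \<open>The recursion starts with an empty fingerprint, where the potential is
  \<open>2 * D * card V\<close>; the last assumption says that \<open>k\<close> shrinkings bring it
  down to \<open>D * R\<close>.\<close>

lemma container_cover:
  fixes w :: "'a \<Rightarrow> 'a \<Rightarrow> real" and D \<beta> R :: real
  assumes "finite V" "0 < D" "0 \<le> R" "0 \<le> \<beta>"
    and "\<And>u v. 0 \<le> w u v" "\<And>u v. w u v \<le> D"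
    and "\<And>U. U \<subseteq> V \<Longrightarrow> R < real (card U) \<Longrightarrow>
      \<exists>v\<in>U. \<beta> * real (card U) \<le> (\<Sum>u\<in>U. w v u)"
    and "2 * real (card V) * exp (- (real k * \<beta> / (2 * D))) \<le> R"
  shows "\<exists>\<C>. finite \<C> \<and> card \<C> \<le> (card V + 1) ^ k \<and>
    (\<forall>C\<in>\<C>. finite C \<and> real (card C) \<le> R + real k) \<and>
    (\<forall>I. I \<subseteq> V \<and> (\<forall>u\<in>I. (\<Sum>t\<in>I. w t u) \<le> D) \<longrightarrow> (\<exists>C\<in>\<C>. I \<subseteq> C))"
proof -
  have "(\<Sum>u\<in>V. 2 * D - (\<Sum>t\<in>{}. w t u)) * exp (- (real k * \<beta> / (2 * D))) \<le> D * R"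
    using mult_left_mono[OF assms(8), of D] assms(2) by (simp add: mult.assoc mult.left_commute)
  then show ?thesis
    using container_cover_aux[of V D R w \<beta> V "{}" k] assms by simp
qed

section \<open>Low-degree sets and the weighted collision graph\<close>

definition low_degree_sets :: "nat \<Rightarrow> nat \<Rightarrow> nat set set" where
  "low_degree_sets n D = {I. I \<subseteq> {1..n} \<and> (\<forall>v\<in>I. sidon_degree I v < D)}"

lemma finite_low_degree_sets: "finite (low_degree_sets n D)"
  by (rule finite_subset[of _ "Pow {1..n}"]) (auto simp: low_degree_sets_def)

lemma finite_sidon_tuples_at:
  assumes "finite A"
  shows "finite (sidon_tuples_at A v)"
  by (rule finite_subset[of _ "A \<times> A \<times> A \<times> A"])
    (use assms in \<open>auto simp: sidon_tuples_at_def sidon_tuples_def\<close>)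

lemma sidon_degree_mono:
  assumes "finite B" "A \<subseteq> B"
  shows "sidon_degree A v \<le> sidon_degree B v"
  unfolding sidon_degree_def
  by (rule card_mono[OF finite_sidon_tuples_at[OF assms(1)]])
    (use assms(2) in \<open>auto simp: sidon_tuples_at_def sidon_tuples_def\<close>)

lemma low_degree_sets_subset:
  assumes "I \<in> low_degree_sets n D" "J \<subseteq> I"
  shows "J \<in> low_degree_sets n D"
proof -
  have "finite I"
    using assms(1) finite_subset[of I "{1..n}"] by (auto simp: low_degree_sets_def)
  then show ?thesis
    using assms order_le_less_trans[OF sidon_degree_mono[of I J]]
    by (auto simp: low_degree_sets_def)
qed

text \<open>The pairs behind the edge weight of \<open>u\<close> and \<open>v\<close>. Since
  \<open>a \<noteq> b\<close> forces \<open>u \<noteq> v\<close>, there are no loops, and for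
  \<open>u\<close>, \<open>v\<close> outside \<open>S\<close> each pair yields a Sidon
  4-tuple.\<close>

definition collisions :: "nat set \<Rightarrow> nat \<Rightarrow> nat \<Rightarrow> (nat \<times> nat) set" where
  "collisions S u v = {(a, b) \<in> S \<times> S. a \<noteq> b \<and> u + a = v + b}"

lemma finite_collisions: "finite S \<Longrightarrow> finite (collisions S u v)"
  by (rule finite_subset[of _ "S \<times> S"]) (auto simp: collisions_def)

text \<open>All pairs have the same difference, so a fixed pair \<open>(a1, b1)\<close> forms a
  Sidon 4-tuple \<open>(a1, b, b1, a)\<close> with every other pair \<open>(a, b)\<close>. Fewer
  than \<open>D\<close> such tuples exist at \<open>a1\<close>, and \<open>(a1, b1)\<close> itself
  adds one.\<close>

lemma card_collisions_le:
  assumes "finite S" "\<And>v. v \<in> S \<Longrightarrow> sidon_degree S v < D"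
  shows "card (collisions S u v) \<le> D"
proof (cases "collisions S u v = {}")
  case False
  then obtain a1 b1 where ab: "(a1, b1) \<in> collisions S u v"
    by (metis ex_in_conv surj_pair)
  then have "a1 \<in> S"
    by (auto simp: collisions_def)
  have "card (collisions S u v - {(a1, b1)}) \<le> card (sidon_tuples_at S a1)"
  proof (rule card_inj_on_le)
    show "inj_on (\<lambda>(a, b). (a1, b, b1, a)) (collisions S u v - {(a1, b1)})"
      by (auto simp: inj_on_def)
    show "(\<lambda>(a, b). (a1, b, b1, a)) ` (collisions S u v - {(a1, b1)}) \<subseteq> sidon_tuples_at S a1"
      using ab by (auto simp: collisions_def sidon_tuples_at_def sidon_tuples_def)
  qed (rule finite_sidon_tuples_at[OF assms(1)])
  also have "\<dots> < D"
    using assms(2)[OF \<open>a1 \<in> S\<close>] by (simp add: sidon_degree_def)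
  finally show ?thesis
    using ab finite_collisions[OF assms(1)] by (simp add: card_Diff_singleton)
qed simp

text \<open>An equation \<open>t + a = u + b\<close> gives the tuple \<open>(u, b, t, a)\<close>;
  its sides are disjoint because \<open>a \<noteq> b\<close> and \<open>t\<close>, \<open>u\<close>
  lie outside \<open>S\<close> while \<open>a\<close>, \<open>b\<close> lie inside.\<close>

lemma sum_card_collisions_le_sidon_degree:
  assumes "finite I" "S \<subseteq> I" "u \<in> I - S"
  shows "(\<Sum>t\<in>I - S. card (collisions S t u)) \<le> sidon_degree I u"
proof -
  have finS: "finite S"
    using assms finite_subset by blast
  have "(\<Sum>t\<in>I - S. card (collisions S t u)) = card (SIGMA t:I - S. collisions S t u)"
    using assms finS by (simp add: finite_collisions)
  also have "\<dots> \<le> card (sidon_tuples_at I u)"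
  proof (rule card_inj_on_le)
    show "inj_on (\<lambda>(t, a, b). (u, b, t, a)) (SIGMA t:I - S. collisions S t u)"
      by (auto simp: inj_on_def)
    show "(\<lambda>(t, a, b). (u, b, t, a)) ` (SIGMA t:I - S. collisions S t u) \<subseteq> sidon_tuples_at I u"
      using assms by (auto simp: collisions_def sidon_tuples_at_def sidon_tuples_def)
  qed (rule finite_sidon_tuples_at[OF assms(1)])
  finally show ?thesis
    by (simp add: sidon_degree_def)
qed

text \<open>The \<open>m = card U * card S\<close> sums \<open>v + a\<close> fall into
  \<open>{1..2*n}\<close>, so by Cauchy--Schwarz at least \<open>m^2 / (2 * n)\<close> solutions of
  \<open>v + a = u + b\<close> exist. Only \<open>m\<close> of them have \<open>a = b\<close>;
  averaging the others over \<open>v\<close> gives the vertex.\<close>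

lemma collisions_dense:
  assumes U: "U \<subseteq> {1..n}" and S: "S \<subseteq> {1..n}"
    and large: "4 * real n / real (card S) < real (card U)" and "card S > 0"
  shows "\<exists>v\<in>U. (real (card S))\<^sup>2 / (4 * real n) * real (card U)
    \<le> (\<Sum>u\<in>U. real (card (collisions S v u)))"
proof -
  have fin: "finite U" "finite S"
    using U S finite_subset by auto
  define m where "m = real (card U) * real (card S)"
  have cU: "card U > 0"
    using order_le_less_trans[OF _ large, of 0] by simp
  have n: "n > 0"
    using cU U by (cases n) auto
  define f where "f z = {(v, a) \<in> U \<times> S. v + a = z}" for z
  have finf: "finite (f z)" for z
    by (rule finite_subset[of _ "U \<times> S"]) (use fin in \<open>auto simp: f_def\<close>)
  have "(\<Sum>z\<in>{1..2*n}. card (f z)) = card (\<Union>z\<in>{1..2*n}. f z)"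
    by (rule card_UN_disjoint[symmetric]) (use finf in \<open>auto simp: f_def\<close>)
  also have "(\<Union>z\<in>{1..2*n}. f z) = U \<times> S"
    using U S by (force simp: f_def)
  finally have sum_f: "(\<Sum>z\<in>{1..2*n}. real (card (f z))) = m"
    by (simp add: m_def card_cartesian_product flip: of_nat_sum)
  have CS: "m\<^sup>2 \<le> real (2 * n) * (\<Sum>z\<in>{1..2*n}. (real (card (f z)))\<^sup>2)"
    using sum_squared_le_sum_of_squares[of "\<lambda>z. real (card (f z))" "{1..2*n}"]
    unfolding sum_f by (simp add: mult.commute)
  define Q where "Q = (SIGMA v:U. SIGMA u:U. collisions S v u)"
  define diag where "diag = (\<lambda>(v, a). (v, v, a, a)) ` (U \<times> S)"
  have finQ: "finite Q"
    unfolding Q_def by (intro finite_SigmaI fin finite_collisions)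
  have "(\<Sum>z\<in>{1..2*n}. card (f z) ^ 2) = (\<Sum>z\<in>{1..2*n}. card (f z \<times> f z))"
    by (simp add: power2_eq_square card_cartesian_product)
  also have "\<dots> = card (\<Union>z\<in>{1..2*n}. f z \<times> f z)"
    by (rule card_UN_disjoint[symmetric]) (use finf in \<open>auto simp: f_def\<close>)
  also have "\<dots> \<le> card (Q \<union> diag)"
  proof (rule card_inj_on_le)
    show "inj_on (\<lambda>((v, a), (u, b)). (v, u, a, b)) (\<Union>z\<in>{1..2*n}. f z \<times> f z)"
      by (auto simp: inj_on_def)
    show "(\<lambda>((v, a), (u, b)). (v, u, a, b)) ` (\<Union>z\<in>{1..2*n}. f z \<times> f z) \<subseteq> Q \<union> diag"
      by (auto simp: f_def Q_def diag_def collisions_def image_iff)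
    show "finite (Q \<union> diag)"
      using finQ fin by (simp add: diag_def)
  qed
  also have "\<dots> \<le> card Q + card diag"
    by (rule card_Un_le)
  also have "card diag \<le> card (U \<times> S)"
    unfolding diag_def by (rule card_image_le) (use fin in auto)
  finally have "(\<Sum>z\<in>{1..2*n}. card (f z) ^ 2) \<le> card Q + card U * card S"
    by (simp add: card_cartesian_product)
  then have "real (\<Sum>z\<in>{1..2*n}. card (f z) ^ 2) \<le> real (card Q + card U * card S)"
    by (rule of_nat_mono)
  then have sq: "(\<Sum>z\<in>{1..2*n}. (real (card (f z)))\<^sup>2) \<le> real (card Q) + m"
    by (simp add: m_def)
  \<comment> \<open>Hence the \<open>m\<close> diagonal solutions are at most half of
    \<open>m^2 / (2 * n)\<close>, which leaves \<open>m^2 / (4 * n)\<close>.\<close>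
  have m_large: "4 * real n \<le> m"
    using large \<open>card S > 0\<close> by (simp add: m_def field_simps)
  have "m\<^sup>2 \<le> 2 * real n * (real (card Q) + m)"
    using CS mult_left_mono[OF sq, of "2 * real n"] by simp
  moreover have "4 * real n * m \<le> m\<^sup>2"
    unfolding power2_eq_square using m_large by (intro mult_right_mono) (auto simp: m_def)
  ultimately have "m\<^sup>2 \<le> 4 * real n * real (card Q)"
    by (simp add: algebra_simps)
  then have Qm: "m\<^sup>2 / (4 * real n) \<le> real (card Q)"
    using n by (simp add: field_simps)
  have Qsum: "real (card Q) = (\<Sum>v\<in>U. \<Sum>u\<in>U. real (card (collisions S v u)))"
    unfolding Q_def using fin by (simp add: finite_collisions)
  show ?thesis
  proof (rule ccontr)
    assume "\<not> ?thesis"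
    then have "real (card Q) < (\<Sum>v\<in>U. (real (card S))\<^sup>2 / (4 * real n) * real (card U))"
      unfolding Qsum using cU fin by (intro sum_strict_mono) auto
    also have "\<dots> = m\<^sup>2 / (4 * real n)"
      by (simp add: m_def power2_eq_square)
    finally show False
      using Qm by simp
  qed
qed

text \<open>The container lemma on \<open>{1..n}\<close>, with collisions in \<open>S\<close> as
  weights, is applied to \<open>I - S\<close>. The assumption on \<open>k\<close> makes the decay
  factor at most \<open>1 / card S\<close>.\<close>

lemma low_degree_containers:
  assumes S: "S \<in> low_degree_sets n D" and s: "card S > 0"
    and k: "8 * real n * real D / (real (card S))\<^sup>2 * ln (real (card S)) \<le> real k"
  shows "\<exists>\<C>. finite \<C> \<and> card \<C> \<le> (n + 1) ^ k \<and>
    (\<forall>C\<in>\<C>. finite C \<and> real (card C) \<le> 4 * real n / real (card S) + real k) \<and>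
    (\<forall>I\<in>low_degree_sets n D. S \<subseteq> I \<longrightarrow> (\<exists>C\<in>\<C>. I \<subseteq> S \<union> C))"
proof -
  let ?s = "real (card S)"
  have Sn: "S \<subseteq> {1..n}" and deg: "\<And>v. v \<in> S \<Longrightarrow> sidon_degree S v < D"
    using S by (auto simp: low_degree_sets_def)
  have fS: "finite S" and "S \<noteq> {}"
    using s card_gt_0_iff by auto
  then obtain v where v: "v \<in> S"
    by blast
  have n: "n > 0" and D: "D > 0"
    using v Sn deg[OF v] by auto
  have decay: "2 * real (card {1..n}) * exp (- (real k * (?s\<^sup>2 / (4 * real n)) / (2 * real D)))
      \<le> 4 * real n / ?s"
  proof -
    have "ln ?s \<le> real k * (?s\<^sup>2 / (4 * real n)) / (2 * real D)"
      using k n D s by (simp add: field_simps)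
    then have "exp (- (real k * (?s\<^sup>2 / (4 * real n)) / (2 * real D))) \<le> exp (- ln ?s)"
      by simp
    also have "\<dots> = 1 / ?s"
      using s by (simp add: exp_minus inverse_eq_divide)
    finally have "2 * real n * exp (- (real k * (?s\<^sup>2 / (4 * real n)) / (2 * real D)))
        \<le> 2 * real n * (1 / ?s)"
      by (intro mult_left_mono) auto
    also have "\<dots> \<le> 4 * real n / ?s"
      using s by (simp add: field_simps)
    finally show ?thesis by simp
  qed
  have "\<exists>\<C>. finite \<C> \<and> card \<C> \<le> (card {1..n} + 1) ^ k \<and>
    (\<forall>C\<in>\<C>. finite C \<and> real (card C) \<le> 4 * real n / ?s + real k) \<and>
    (\<forall>I. I \<subseteq> {1..n} \<and> (\<forall>u\<in>I. (\<Sum>t\<in>I. real (card (collisions S t u))) \<le> real D)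
        \<longrightarrow> (\<exists>C\<in>\<C>. I \<subseteq> C))"
  proof (rule container_cover[where \<beta> = "?s\<^sup>2 / (4 * real n)"])
    show "real (card (collisions S u v)) \<le> real D" for u v
      using card_collisions_le[OF fS deg] by simp
  qed (use D decay collisions_dense[OF _ Sn _ s] in auto)
  then obtain \<C> where C: "finite \<C>" "card \<C> \<le> (card {1..n} + 1) ^ k"
    "\<forall>C\<in>\<C>. finite C \<and> real (card C) \<le> 4 * real n / ?s + real k"
    "\<forall>I. I \<subseteq> {1..n} \<and> (\<forall>u\<in>I. (\<Sum>t\<in>I. real (card (collisions S t u))) \<le> real D)
        \<longrightarrow> (\<exists>C\<in>\<C>. I \<subseteq> C)"
    by (elim exE conjE)
  have "\<exists>C\<in>\<C>. I \<subseteq> S \<union> C" if I: "I \<in> low_degree_sets n D" "S \<subseteq> I" for I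
  proof -
    have In: "I \<subseteq> {1..n}" "finite I"
      using I finite_subset[of I "{1..n}"] by (auto simp: low_degree_sets_def)
    have "(\<Sum>t\<in>I - S. real (card (collisions S t u))) \<le> real D" if "u \<in> I - S" for u
    proof -
      have "(\<Sum>t\<in>I - S. card (collisions S t u)) \<le> sidon_degree I u"
        using sum_card_collisions_le_sidon_degree[OF In(2) I(2) that] .
      also have "\<dots> \<le> D"
        using I(1) that by (auto simp: low_degree_sets_def less_imp_le)
      finally show ?thesis
        by (simp flip: of_nat_sum)
    qed
    then have "\<exists>C\<in>\<C>. I - S \<subseteq> C"
      using In(1) by (intro C(4)[rule_format]) auto
    then show ?thesis
      by blast
  qed
  then show ?thesis
    using C(1-3) by (intro exI[of _ \<C>]) auto
qed

section \<open>Counting the low-degree sets that contain a given set\<close>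

definition extensions :: "nat \<Rightarrow> nat \<Rightarrow> nat set \<Rightarrow> nat set set" where
  "extensions n D S = {I \<in> low_degree_sets n D. S \<subseteq> I}"

lemma finite_extensions: "finite (extensions n D S)"
  by (rule finite_subset[OF _ finite_low_degree_sets]) (auto simp: extensions_def)

lemma card_UN_le_mult:
  fixes B :: real
  assumes "finite A" "\<And>x. x \<in> A \<Longrightarrow> real (card (F x)) \<le> B"
  shows "real (card (\<Union>x\<in>A. F x)) \<le> real (card A) * B"
proof -
  have "real (card (\<Union>x\<in>A. F x)) \<le> real (\<Sum>x\<in>A. card (F x))"
    using card_UN_le[OF assms(1)] by (rule of_nat_mono)
  also have "\<dots> \<le> real (card A) * B"
    using sum_bounded_above[of A "\<lambda>x. real (card (F x))" B] assms(2) by simp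
  finally show ?thesis .
qed

text \<open>The end of the doubling: \<open>I\<close> is determined by \<open>I - S\<close>, which
  is chosen among all subsets of a container.\<close>

lemma card_extensions_le_terminal:
  assumes s: "card S > 0"
    and k: "8 * real n * real D / (real (card S))\<^sup>2 * ln (real (card S)) \<le> real k"
  shows "real (card (extensions n D S))
    \<le> real (n + 1) ^ k * 2 powr (4 * real n / real (card S) + real k)"
proof (cases "S \<in> low_degree_sets n D")
  case False
  \<comment> \<open>Low degree passes to subsets, so a set without it has no low-degree
    superset.\<close>
  then have "extensions n D S = {}"
    using low_degree_sets_subset by (auto simp: extensions_def)
  then show ?thesis by simp
next
  case True
  obtain \<C> where C: "finite \<C>" "card \<C> \<le> (n + 1) ^ k"
    "\<forall>C\<in>\<C>. finite C \<and> real (card C) \<le> 4 * real n / real (card S) + real k"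
    "\<forall>I\<in>low_degree_sets n D. S \<subseteq> I \<longrightarrow> (\<exists>C\<in>\<C>. I \<subseteq> S \<union> C)"
    using low_degree_containers[OF True s k] by (elim exE conjE)
  let ?F = "\<lambda>C. (\<lambda>X. S \<union> X) ` Pow C"
  have "extensions n D S \<subseteq> (\<Union>C\<in>\<C>. ?F C)"
  proof
    fix I assume "I \<in> extensions n D S"
    then have I: "I \<in> low_degree_sets n D" "S \<subseteq> I"
      by (auto simp: extensions_def)
    then obtain C where "C \<in> \<C>" "I \<subseteq> S \<union> C"
      using C(4) by blast
    moreover from this have "I = S \<union> (I - S)" "I - S \<in> Pow C"
      using I by auto
    ultimately show "I \<in> (\<Union>C\<in>\<C>. ?F C)"
      by blast
  qed
  then have "card (extensions n D S) \<le> card (\<Union>C\<in>\<C>. ?F C)"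
    using C by (intro card_mono) auto
  also have "real \<dots> \<le> real (card \<C>) * 2 powr (4 * real n / real (card S) + real k)"
  proof (rule card_UN_le_mult[OF C(1)])
    fix C assume c: "C \<in> \<C>"
    have "card (?F C) \<le> card (Pow C)"
      using C(3)[rule_format, OF c] by (intro card_image_le) auto
    then have "real (card (?F C)) \<le> 2 powr real (card C)"
      using C(3)[rule_format, OF c] by (simp add: card_Pow powr_realpow)
    also have "\<dots> \<le> 2 powr (4 * real n / real (card S) + real k)"
      using C(3)[rule_format, OF c] by (intro powr_mono) auto
    finally show "real (card (?F C)) \<le> 2 powr (4 * real n / real (card S) + real k)" .
  qed
  also have "\<dots> \<le> real (n + 1) ^ k * 2 powr (4 * real n / real (card S) + real k)"
    using of_nat_mono[OF C(2), where 'a = real] by (intro mult_right_mono) auto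
  finally show ?thesis by simp
qed

text \<open>An extension with fewer than \<open>card S\<close> new elements is listed outright; any
  other contains \<open>S \<union> X\<close> for some \<open>X\<close> of \<open>card S\<close> new
  elements from a container, and is counted by \<open>B\<close>. The condition
  \<open>1 \<le> B\<close> covers the first kind.\<close>

lemma card_extensions_le_doubling:
  fixes B :: real
  assumes s: "card S > 0"
    and k: "8 * real n * real D / (real (card S))\<^sup>2 * ln (real (card S)) \<le> real k"
    and kn: "real k \<le> real n / real (card S)" and sn: "(real (card S))\<^sup>2 \<le> 5 * real n"
    and B: "1 \<le> B" "\<And>S'. card S' = 2 * card S \<Longrightarrow> real (card (extensions n D S')) \<le> B"
  shows "real (card (extensions n D S))
    \<le> real (n + 1) ^ k * ((exp 1 * (5 * real n / real (card S)) / real (card S)) ^ card S * B)"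
proof (cases "S \<in> low_degree_sets n D")
  case False
  then have "extensions n D S = {}"
    using low_degree_sets_subset by (auto simp: extensions_def)
  then show ?thesis using B(1) by simp
next
  case True
  obtain \<C> where C: "finite \<C>" "card \<C> \<le> (n + 1) ^ k"
    "\<forall>C\<in>\<C>. finite C \<and> real (card C) \<le> 4 * real n / real (card S) + real k"
    "\<forall>I\<in>low_degree_sets n D. S \<subseteq> I \<longrightarrow> (\<exists>C\<in>\<C>. I \<subseteq> S \<union> C)"
    using low_degree_containers[OF True s k] by (elim exE conjE)
  have fS: "finite S"
    using s card_gt_0_iff by auto
  let ?K = "(exp 1 * (5 * real n / real (card S)) / real (card S)) ^ card S"
  let ?G = "\<lambda>X. if card (S \<union> X) = 2 * card S then extensions n D (S \<union> X) else {S \<union> X}"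
  let ?A = "\<lambda>C. {X. X \<subseteq> C \<and> card X \<le> card S}"
  let ?F = "\<lambda>C. \<Union>X\<in>?A C. ?G X"
  have finA: "finite (?A C)" if "C \<in> \<C>" for C
    using C(3)[rule_format, OF that] by auto
  have "extensions n D S \<subseteq> (\<Union>C\<in>\<C>. ?F C)"
  proof
    fix I assume "I \<in> extensions n D S"
    then have I: "I \<in> low_degree_sets n D" "S \<subseteq> I"
      by (auto simp: extensions_def)
    then have fI: "finite I"
      using finite_subset[of I "{1..n}"] by (auto simp: low_degree_sets_def)
    obtain C where c: "C \<in> \<C>" "I \<subseteq> S \<union> C"
      using I C(4) by blast
    have "\<exists>X\<in>?A C. I \<in> ?G X"
    proof (cases "card (I - S) < card S")
      case True
      then have "card (S \<union> (I - S)) \<noteq> 2 * card S"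
        using card_Un_le[of S "I - S"] by linarith
      moreover have "S \<union> (I - S) = I"
        using I by auto
      ultimately show ?thesis
        using c True by (intro bexI[of _ "I - S"]) auto
    next
      case False
      then obtain X where X: "X \<subseteq> I - S" "card X = card S"
        using obtain_subset_with_card_n by (metis not_less)
      then have "card (S \<union> X) = 2 * card S"
        using fS fI by (subst card_Un_disjoint) (auto intro: finite_subset)
      then show ?thesis
        using X c I by (intro bexI[of _ X]) (auto simp: extensions_def)
    qed
    then show "I \<in> (\<Union>C\<in>\<C>. ?F C)"
      using c by blast
  qed
  then have "card (extensions n D S) \<le> card (\<Union>C\<in>\<C>. ?F C)"
    using C(1) finA by (intro card_mono) (auto simp: finite_extensions)
  also have "real \<dots> \<le> real (card \<C>) * (?K * B)"
  proof (rule card_UN_le_mult[OF C(1)])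
    fix C assume c: "C \<in> \<C>"
    have "real (card (?F C)) \<le> real (card (?A C)) * B"
      using B by (intro card_UN_le_mult[OF finA[OF c]]) auto
    also have "real (card (?A C)) \<le> ?K"
    proof (rule card_small_subsets_le)
      \<comment> \<open>The container bound \<open>4 * n / s\<close> plus
        \<open>k \<le> n / s\<close>.\<close>
      show "real (card C) \<le> 5 * real n / real (card S)"
        using C(3)[rule_format, OF c] kn by simp
      show "real (card S) \<le> 5 * real n / real (card S)"
        using sn s by (simp add: field_simps power2_eq_square)
    qed (use C(3)[rule_format, OF c] s in auto)
    finally show "real (card (?F C)) \<le> ?K * B"
      using B(1) by (simp add: mult_right_mono)
  qed
  also have "\<dots> \<le> real (n + 1) ^ k * (?K * B)"
    using of_nat_mono[OF C(2), where 'a = real] B(1) by (intro mult_right_mono) auto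
  finally show ?thesis by simp
qed

section \<open>Explicit parameters for a fixed large \<open>n\<close>, and the cost of all
  doublings\<close>

lemma log2_le_double: "1 \<le> x \<Longrightarrow> log 2 x \<le> 2 * x"
proof -
  assume x: "1 \<le> x"
  have l: "1 / 2 \<le> ln (2::real)"
    using ln_le_minus_one[of "1 / 2 :: real"] by (simp add: ln_div)
  have "ln x \<le> x"
    using x ln_le_minus_one[of x] by simp
  also have "\<dots> \<le> 2 * x * ln 2"
    using mult_left_mono[OF l, of "2 * x"] x by simp
  finally show "log 2 x \<le> 2 * x"
    using l by (simp add: log_def pos_divide_le_eq)
qed

context
  fixes n D :: nat and r L :: real
  assumes r_def: "r = sqrt (real n)" and L_def: "L = log 2 (real n)"
    and D_def: "D = nat \<lceil>r / L ^ 4\<rceil>"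
    and L: "5 \<le> L" and rL: "L ^ 4 \<le> r"
begin

lemma r_sq: "real n = r\<^sup>2"
  by (simp add: r_def)

lemma L3_le: "L ^ 3 \<le> r" and r_ge: "5 * L \<le> r" and r_ge_25: "25 \<le> r"
proof -
  have "L ^ 3 \<le> L ^ 4"
    using L by (intro power_increasing) auto
  then show 3: "L ^ 3 \<le> r"
    using rL by linarith
  have "L * 5 \<le> L * L"
    using L by (intro mult_left_mono) auto
  also have "L * L \<le> L * L * L"
    using L mult_left_mono[of 1 L "L * L"] by simp
  finally show 4: "5 * L \<le> r"
    using 3 by (simp add: power3_eq_cube)
  then show "25 \<le> r"
    using L by linarith
qed

lemma r_le_n: "2 * r \<le> real n"
  using mult_right_mono[of 2 r r] r_ge_25 by (simp add: r_sq power2_eq_square)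

lemma n_powr: "real n = 2 powr L"
  using r_le_n r_ge_25 by (simp add: L_def)

text \<open>Spending \<open>2 * L\<close> bits per element is crude, but it is affordable for sets
  of about \<open>r / L\<close> elements.\<close>

lemma card_small_subsets_atLeastAtMost_le:
  assumes "0 < s" "s \<le> n"
  shows "real (card {X. X \<subseteq> {1..n} \<and> card X \<le> s}) \<le> 2 powr (2 * L * real s)"
proof -
  have "real (card {X. X \<subseteq> {1..n} \<and> card X \<le> s}) \<le> (exp 1 * real n / real s) ^ s"
    using assms by (intro card_small_subsets_le) auto
  also have "\<dots> \<le> (real n * real n) ^ s"
  proof (rule power_mono)
    have "exp 1 * real n / real s \<le> exp 1 * real n"
      using assms by (simp add: divide_le_eq mult_left_mono)
    also have "\<dots> \<le> real n * real n"
      using r_le_n r_ge_25 exp_le by (intro mult_right_mono) auto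
    finally show "exp 1 * real n / real s \<le> real n * real n" .
  qed auto
  also have "\<dots> = 2 powr (2 * L * real s)"
    by (simp add: n_powr powr_add[symmetric] powr_powr powr_realpow[symmetric])
  finally show ?thesis .
qed

text \<open>
  The middle term exceeds the total cost of all fingerprints used at sizes \<open>s, 2s, 4s, \<dots>\<close>. The last
  term telescopes: doubling \<open>s\<close> increases it by \<open>s (4 + 2 log (r / s))\<close>, which pays for choosing the
  next \<open>s\<close> elements inside a container of size \<open>5 n / s\<close>.
\<close>

definition budget :: "nat \<Rightarrow> real" where
  "budget s = 21 * r + 54 * (r ^ 3 / (L\<^sup>2 * (real s)\<^sup>2)) - real s * (8 + 2 * log 2 (r / real s))"

text \<open>The fingerprint length is of order \<open>n * D * L / s^2\<close>, that is
  \<open>r^3 / (L^3 * s^2)\<close>, and each of its elements costs at most \<open>2 * L\<close>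
  bits.\<close>

lemma fingerprint_size:
  assumes s: "r / L \<le> real s" "real s \<le> 2 * r"
  obtains k where "8 * real n * real D / (real s)\<^sup>2 * ln (real s) \<le> real k"
    "real k \<le> real n / real s"
    "real (n + 1) ^ k \<le> 2 powr (40 * (r ^ 3 / (L\<^sup>2 * (real s)\<^sup>2)))"
proof -
  define k where "k = nat \<lceil>8 * real n * real D / (real s)\<^sup>2 * L\<rceil>"
  have pos: "0 < r" "0 < L"
    using r_ge_25 L by auto
  have s0: "0 < real s"
    using s(1) pos by (smt (verit) divide_pos_pos)
  have "ln (real s) \<le> ln (real n)"
    using s0 s(2) r_le_n by simp
  also have "\<dots> \<le> L"
    unfolding L_def log_def using r_le_n r_ge_25 ln_2_less_1
    by (simp add: pos_le_divide_eq mult_left_le)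
  finally have "8 * real n * real D / (real s)\<^sup>2 * ln (real s) \<le> 8 * real n * real D / (real s)\<^sup>2 * L"
    by (intro mult_left_mono) auto
  also have "\<dots> \<le> real k"
    unfolding k_def by linarith
  finally have k1: "8 * real n * real D / (real s)\<^sup>2 * ln (real s) \<le> real k" .
  have "1 \<le> r / L ^ 4"
    using rL pos by simp
  then have D: "real D \<le> 2 * (r / L ^ 4)"
    unfolding D_def by linarith
  define q where "q = r ^ 3 / (L ^ 3 * (real s)\<^sup>2)"
  \<comment> \<open>Aim: \<open>q\<close> is at least \<open>1 / 4\<close>, so rounding
    \<open>k\<close> up costs at most \<open>4 * q\<close> beyond the main term
    \<open>16 * q\<close>.\<close>
  have "(real s)\<^sup>2 \<le> (2 * r)\<^sup>2"
    using s s0 by (intro power_mono) auto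
  then have "L ^ 3 * (real s)\<^sup>2 \<le> r * (2 * r)\<^sup>2"
    using L3_le pos by (intro mult_mono) auto
  then have q: "1 \<le> 4 * q"
    using pos s0 by (simp add: q_def field_simps power2_eq_square power3_eq_cube)
  have "8 * real n * real D / (real s)\<^sup>2 * L \<le> 8 * real n * (2 * (r / L ^ 4)) / (real s)\<^sup>2 * L"
    using D pos by (intro mult_right_mono divide_right_mono mult_left_mono) auto
  also have "\<dots> = 16 * q"
    using pos s0 by (simp add: q_def r_sq field_simps power2_eq_square power3_eq_cube eval_nat_numeral)
  finally have "8 * real n * real D / (real s)\<^sup>2 * L \<le> 16 * q" .
  moreover have "0 \<le> 8 * real n * real D / (real s)\<^sup>2 * L"
    using pos by simp
  then have "real k \<le> 8 * real n * real D / (real s)\<^sup>2 * L + 1"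
    unfolding k_def using of_int_ceiling_le_add_one by simp
  ultimately have kq: "real k \<le> 20 * q"
    using q by linarith
  \<comment> \<open>Here \<open>L^2 \<ge> 25\<close> and \<open>s \<ge> r / L\<close> combine to
    keep the fingerprint below \<open>n / s\<close>.\<close>
  have "20 * r \<le> L\<^sup>2 * r"
    using mult_mono[of 5 L 5 L] L pos by (intro mult_right_mono) (auto simp: power2_eq_square)
  also have "\<dots> \<le> L\<^sup>2 * (L * real s)"
    using s(1) pos by (intro mult_left_mono) (auto simp: field_simps)
  finally have "20 * r \<le> L ^ 3 * real s"
    by (simp add: power2_eq_square power3_eq_cube)
  then have "20 * r * (r\<^sup>2 * real s) \<le> L ^ 3 * real s * (r\<^sup>2 * real s)"
    using pos by (intro mult_right_mono) auto
  then have "20 * q \<le> real n / real s"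
    using pos s0 by (simp add: q_def r_sq field_simps power2_eq_square power3_eq_cube)
  then have k2: "real k \<le> real n / real s"
    using kq by linarith
  have "real (n + 1) \<le> real n * real n"
  proof -
    have "real n * 2 \<le> real n * real n"
      using r_le_n r_ge_25 by (intro mult_left_mono) auto
    moreover have "real (n + 1) \<le> real n * 2"
      using r_le_n r_ge_25 by simp
    ultimately show ?thesis
      by linarith
  qed
  then have "real (n + 1) ^ k \<le> (real n * real n) ^ k"
    by (intro power_mono) auto
  also have "\<dots> = 2 powr (2 * L * real k)"
    by (simp add: n_powr powr_add[symmetric] powr_powr powr_realpow[symmetric])
  also have "\<dots> \<le> 2 powr (2 * L * (20 * q))"
    using kq pos by (intro powr_mono mult_left_mono) auto
  also have "2 * L * (20 * q) = 40 * (r ^ 3 / (L\<^sup>2 * (real s)\<^sup>2))"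
    using pos s0 by (simp add: q_def field_simps power2_eq_square power3_eq_cube)
  finally show thesis
    using that[OF k1 k2] by simp
qed

text \<open>Induction along the doublings of \<open>card S\<close>. The range ends at
  \<open>2 * r\<close> because the last doubling starts below \<open>r\<close>.\<close>

lemma card_extensions_le_budget:
  "r / L \<le> real (card S) \<Longrightarrow> real (card S) \<le> 2 * r \<Longrightarrow>
    real (card (extensions n D S)) \<le> 2 powr budget (card S)"
proof (induction "2 * n - card S" arbitrary: S rule: less_induct)
  case less
  define s where "s = card S"
  have pos: "0 < r" "0 < L"
    using r_ge_25 L by auto
  have s: "r / L \<le> real s" "real s \<le> 2 * r"
    using less.prems by (auto simp: s_def)
  have s0: "0 < real s"
    using s(1) pos by (smt (verit) divide_pos_pos)
  obtain k where k: "8 * real n * real D / (real s)\<^sup>2 * ln (real s) \<le> real k"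
    "real k \<le> real n / real s"
    "real (n + 1) ^ k \<le> 2 powr (40 * (r ^ 3 / (L\<^sup>2 * (real s)\<^sup>2)))"
    using fingerprint_size[OF s] .
  define Q where "Q = r ^ 3 / (L\<^sup>2 * (real s)\<^sup>2)"
  have Q0: "0 \<le> Q"
    using pos by (simp add: Q_def)
  show ?case
  proof (cases "r \<le> real s")
    case True
    have "real n / real s \<le> r"
      using True s0 pos by (simp add: r_sq field_simps power2_eq_square)
    then have e: "4 * real n / real s + real k \<le> 5 * r"
      using k(2) by simp
    have "log 2 (r / real s) \<le> 0"
      using True s0 pos by simp
    then have "real s * (8 + 2 * log 2 (r / real s)) \<le> real s * 8"
      using s0 by (intro mult_left_mono) auto
    \<comment> \<open>Since \<open>s \<le> 2 * r\<close>, the part \<open>21 * r - 8 * s\<close>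
      still leaves the \<open>5 * r\<close> bits for the subsets of the container.\<close>
    then have b: "40 * Q + 5 * r \<le> budget s"
      unfolding budget_def Q_def[symmetric] using s(2) Q0 by simp
    have "real (card (extensions n D S))
        \<le> real (n + 1) ^ k * 2 powr (4 * real n / real s + real k)"
      unfolding s_def by (rule card_extensions_le_terminal) (use k s0 in \<open>auto simp: s_def\<close>)
    also have "\<dots> \<le> 2 powr (40 * Q) * 2 powr (5 * r)"
      using k(3) e by (intro mult_mono powr_mono) (auto simp: Q_def)
    also have "\<dots> \<le> 2 powr budget s"
      unfolding powr_add[symmetric] using b by (intro powr_mono) auto
    finally show ?thesis
      by (simp add: s_def)
  next
    case False
    have bound2: "real (card (extensions n D S')) \<le> 2 powr budget (2 * s)" if "card S' = 2 * s" for S'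
    proof -
      have "2 * n - card S' < 2 * n - card S"
        using that s0 False r_le_n by (simp add: s_def)
      moreover have "r / L \<le> real (card S')" "real (card S') \<le> 2 * r"
        using that s s0 False by auto
      ultimately show ?thesis
        using less.hyps[of S'] that by simp
    qed
    define l where "l = log 2 (r / real s)"
    have l2: "log 2 (r / real (2 * s)) = l - 1"
    proof -
      have "r / real s = 2 * (r / real (2 * s))"
        using s0 by simp
      then have "l = log 2 2 + log 2 (r / real (2 * s))"
        unfolding l_def using s0 pos by (metis log_mult_pos divide_pos_pos of_nat_mult
            of_nat_numeral mult_pos_pos zero_less_numeral)
      then show ?thesis by simp
    qed
    have budget2: "budget (2 * s) = 21 * r + 27 / 2 * Q - 2 * real s * (6 + 2 * l)"
      unfolding budget_def l2 using s0 pos by (simp add: Q_def power_mult_distrib field_simps)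
    \<comment> \<open>This gives \<open>s * l \<le> 2 * r\<close>, so the next budget is at least
      \<open>21 * r - 12 * r - 8 * r \<ge> 0\<close>, as the condition \<open>1 \<le> B\<close>
      requires.\<close>
    have "l \<le> 2 * (r / real s)"
      unfolding l_def by (rule log2_le_double) (use False s0 in simp)
    then have "real s * l \<le> real s * (2 * (r / real s))"
      using s0 by (intro mult_left_mono) auto
    then have "real s * l \<le> 2 * r"
      using s0 by simp
    then have "0 \<le> budget (2 * s)"
      unfolding budget2 using Q0 False by (simp add: algebra_simps)
    then have B1: "1 \<le> 2 powr budget (2 * s)"
      by (simp add: ge_one_powr_ge_zero)
    have sn: "(real s)\<^sup>2 \<le> 5 * real n"
    proof -
      have "(real s)\<^sup>2 \<le> r\<^sup>2"
        using False by (intro power_mono) auto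
      also have "\<dots> \<le> 5 * r\<^sup>2"
        by simp
      finally show ?thesis
        by (simp add: r_sq)
    qed
    have "real (card (extensions n D S))
      \<le> real (n + 1) ^ k * ((exp 1 * (5 * real n / real s) / real s) ^ s * 2 powr budget (2 * s))"
      unfolding s_def by (rule card_extensions_le_doubling)
        (use k s0 sn B1 bound2 in \<open>auto simp: s_def\<close>)
    also have "\<dots> \<le> 2 powr (40 * Q) * (2 powr (real s * (4 + 2 * l)) * 2 powr budget (2 * s))"
    proof (intro mult_mono)
      have "exp 1 * (5 * real n / real s) / real s = 5 * exp 1 * (r / real s)\<^sup>2"
        using s0 by (simp add: r_sq power2_eq_square field_simps)
      \<comment> \<open>From \<open>5 * exp 1 \<le> 15\<close>; the factor \<open>16\<close> is the
        \<open>4\<close> in the exponent.\<close>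
      also have "\<dots> \<le> 16 * (r / real s)\<^sup>2"
        using exp_le by (intro mult_right_mono) auto
      also have "\<dots> = 2 powr (4 + 2 * l)"
      proof -
        have "2 powr l = r / real s"
          unfolding l_def using s0 pos by simp
        then have "2 powr (2 * l) = (r / real s)\<^sup>2"
          by (metis mult_2 powr_add power2_eq_square)
        then show ?thesis
          by (simp add: powr_add)
      qed
      finally have "(exp 1 * (5 * real n / real s) / real s) ^ s \<le> (2 powr (4 + 2 * l)) ^ s"
        by (intro power_mono) auto
      then show "(exp 1 * (5 * real n / real s) / real s) ^ s \<le> 2 powr (real s * (4 + 2 * l))"
        by (simp add: powr_powr powr_realpow[symmetric] mult.commute)
    qed (use k(3) in \<open>auto simp: Q_def\<close>)
    also have "\<dots> = 2 powr (40 * Q + (real s * (4 + 2 * l) + budget (2 * s)))"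
      by (simp add: powr_add)
    also have "\<dots> \<le> 2 powr budget s"
    proof (rule powr_mono)
      \<comment> \<open>The terms in \<open>s\<close> cancel exactly, and doubling \<open>s\<close>
        divides \<open>Q\<close> by four, so \<open>40 + 54 / 4 \<le> 54\<close> is all that
        remains.\<close>
      show "40 * Q + (real s * (4 + 2 * l) + budget (2 * s)) \<le> budget s"
        unfolding budget2 unfolding budget_def Q_def[symmetric] l_def[symmetric]
        using Q0 by (simp add: algebra_simps)
    qed auto
    finally show ?thesis
      by (simp add: s_def)
  qed
qed

text \<open>Choosing the first \<open>s\<close> elements, with \<open>s\<close> about
  \<open>r / L\<close>, costs \<open>4 * r\<close> bits. At this size the fingerprint term of the
  budget is at most \<open>54 * r\<close>, hence the budget is at most
  \<open>75 * r\<close>.\<close>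

lemma card_low_degree_sets_le: "real (card (low_degree_sets n D)) \<le> 2 powr (79 * r)"
proof -
  define s where "s = nat \<lceil>r / L\<rceil>"
  have pos: "0 < r" "0 < L"
    using r_ge_25 L by auto
  have rL1: "1 \<le> r / L"
    using r_ge pos by simp
  have "r / L \<le> r / 5"
    using L pos by (intro divide_left_mono) auto
  then have s: "r / L \<le> real s" "real s \<le> 2 * (r / L)" "real s \<le> r" "0 < s"
    using rL1 pos unfolding s_def by linarith+
  let ?A = "{X. X \<subseteq> {1..n} \<and> card X \<le> s}"
  let ?G = "\<lambda>X. if card X = s then extensions n D X else {X}"
  have "(r / L)\<^sup>2 \<le> (real s)\<^sup>2"
    using s(1) rL1 by (intro power_mono) auto
  then have "r * (r / L)\<^sup>2 \<le> r * (real s)\<^sup>2"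
    using pos by (intro mult_left_mono) auto
  then have "r ^ 3 / (L\<^sup>2 * (real s)\<^sup>2) \<le> r"
    using pos s(4) by (simp add: field_simps power2_eq_square power3_eq_cube)
  moreover have "0 \<le> real s * (8 + 2 * log 2 (r / real s))"
    using s pos by (intro mult_nonneg_nonneg add_nonneg_nonneg) auto
  ultimately have budget: "budget s \<le> 75 * r"
    unfolding budget_def by linarith
  have "low_degree_sets n D \<subseteq> (\<Union>X\<in>?A. ?G X)"
  proof
    fix I assume I: "I \<in> low_degree_sets n D"
    then have In: "I \<subseteq> {1..n}"
      by (auto simp: low_degree_sets_def)
    show "I \<in> (\<Union>X\<in>?A. ?G X)"
    proof (cases "card I < s")
      case True
      then show ?thesis
        using In by (intro UN_I[of I]) auto
    next
      case False
      then obtain X where "X \<subseteq> I" "card X = s"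
        using obtain_subset_with_card_n by (metis not_less)
      then show ?thesis
        using In I by (intro UN_I[of X]) (auto simp: extensions_def)
    qed
  qed
  then have "card (low_degree_sets n D) \<le> card (\<Union>X\<in>?A. ?G X)"
    by (intro card_mono) (auto simp: finite_extensions)
  also have "real \<dots> \<le> real (card ?A) * 2 powr (75 * r)"
  proof (rule card_UN_le_mult)
    fix X assume "X \<in> ?A"
    have "real (card (extensions n D X)) \<le> 2 powr (75 * r)" if "card X = s"
    proof -
      have "real (card (extensions n D X)) \<le> 2 powr budget (card X)"
        using card_extensions_le_budget[of X] s pos that by simp
      also have "\<dots> \<le> 2 powr (75 * r)"
        using budget that by (intro powr_mono) auto
      finally show ?thesis .
    qed
    moreover have "1 \<le> 2 powr (75 * r)"
      using pos by (simp add: ge_one_powr_ge_zero)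
    ultimately show "real (card (?G X)) \<le> 2 powr (75 * r)"
      by simp
  qed simp
  also have "\<dots> \<le> 2 powr (4 * r) * 2 powr (75 * r)"
  proof (rule mult_right_mono)
    have "real (card ?A) \<le> 2 powr (2 * L * real s)"
      using s r_le_n pos by (intro card_small_subsets_atLeastAtMost_le) auto
    also have "\<dots> \<le> 2 powr (4 * r)"
      using mult_left_mono[OF s(2), of "2 * L"] pos by (intro powr_mono) auto
    finally show "real (card ?A) \<le> 2 powr (4 * r)" .
  qed simp
  also have "\<dots> = 2 powr (79 * r)"
    by (simp flip: powr_add)
  finally show ?thesis by simp
qed

section \<open>Reinserting the elements of large degree\<close>

text \<open>Removing the at most \<open>r / L\<close> elements of large degree leaves a low-degree
  set, since degrees only drop. The removed set costs \<open>2 * r\<close> bits, for a total of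
  \<open>81 * r\<close>.\<close>

lemma card_sidon_family_le: "real (card (sidon_family n \<alpha>)) \<le> 2 powr (180 * r)"
proof -
  define b where "b = nat \<lfloor>r / L\<rfloor>"
  have pos: "0 < r" "0 < L"
    using r_ge_25 L by auto
  have rL1: "1 \<le> r / L"
    using r_ge pos by simp
  have "r / L \<le> r / 5"
    using L pos by (intro divide_left_mono) auto
  then have b: "real b \<le> r / L" "0 < b" "real b \<le> r"
    using rL1 pos unfolding b_def by linarith+
  let ?A = "{X. X \<subseteq> {1..n} \<and> card X \<le> b}"
  have "sidon_family n \<alpha> \<subseteq> (\<lambda>(X, Y). X \<union> Y) ` (?A \<times> low_degree_sets n D)"
  proof
    fix I assume I: "I \<in> sidon_family n \<alpha>"
    define X where "X = {v \<in> I. r / L ^ 4 \<le> real (sidon_degree I v)}"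
    have In: "I \<subseteq> {1..n}"
      using I by (simp add: sidon_family_def generalized_sidon_def)
    then have fI: "finite I"
      using finite_subset by blast
    have "real (card X) \<le> r / L"
      using I by (simp add: sidon_family_def X_def r_def L_def)
    then have "card X \<le> b"
      unfolding b_def by linarith
    then have X: "X \<in> ?A"
      using In by (auto simp: X_def)
    have "sidon_degree (I - X) v < D" if "v \<in> I - X" for v
    proof -
      have "real (sidon_degree (I - X) v) \<le> real (sidon_degree I v)"
        using sidon_degree_mono[OF fI, of "I - X" v] by simp
      also have "\<dots> < r / L ^ 4"
        using that by (auto simp: X_def)
      finally show ?thesis
        unfolding D_def by linarith
    qed
    then have "I - X \<in> low_degree_sets n D"
      using In by (auto simp: low_degree_sets_def)
    moreover have "I = X \<union> (I - X)"
      by (auto simp: X_def)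
    ultimately show "I \<in> (\<lambda>(X, Y). X \<union> Y) ` (?A \<times> low_degree_sets n D)"
      using X by (intro image_eqI[of _ _ "(X, I - X)"]) auto
  qed
  then have "card (sidon_family n \<alpha>) \<le> card (?A \<times> low_degree_sets n D)"
    by (intro surj_card_le) (auto simp: finite_low_degree_sets)
  then have "real (card (sidon_family n \<alpha>)) \<le> real (card ?A) * real (card (low_degree_sets n D))"
    unfolding card_cartesian_product of_nat_mult[symmetric] by (rule of_nat_mono)
  also have "\<dots> \<le> 2 powr (2 * r) * 2 powr (79 * r)"
  proof (rule mult_mono[OF _ card_low_degree_sets_le])
    have "real (card ?A) \<le> 2 powr (2 * L * real b)"
      using b r_le_n pos by (intro card_small_subsets_atLeastAtMost_le) auto
    also have "\<dots> \<le> 2 powr (2 * r)"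
      using mult_left_mono[OF b(1), of "2 * L"] pos by (intro powr_mono) auto
    finally show "real (card ?A) \<le> 2 powr (2 * r)" .
  qed auto
  also have "\<dots> \<le> 2 powr (180 * r)"
    unfolding powr_add[symmetric] using pos by (intro powr_mono) auto
  finally show ?thesis .
qed

end

theorem theorem1p2:
  shows "\<forall>\<^sub>F n :: nat in sequentially.
    real (card (sidon_family n (real n / (log 2 (real n)) ^ 4))) \<le> 2 powr (180 * sqrt (real n))"
proof -
  \<comment> \<open>These two growth conditions are what the estimates for fixed \<open>n\<close>
    require of \<open>n\<close>.\<close>
  have "\<forall>\<^sub>F n :: nat in sequentially. 5 \<le> log 2 (real n)"
    by real_asymp
  moreover have "\<forall>\<^sub>F n :: nat in sequentially. log 2 (real n) ^ 4 \<le> sqrt (real n)"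
    by real_asymp
  ultimately show ?thesis
    by eventually_elim (rule card_sidon_family_le[OF refl refl refl])
qed

end
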